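(* Let $G$ be a graph with adjacency matrix $A$, and suppose $G$ has an equitable partition with normalized indicator matrix $P$ and symmetrized divisor matrix $d$. Then $$d=\mathcal{R}(\lambda,P,A).$$
   Context: A partition $\Pi=(V_1,\dots,V_k)$ of the vertex set of a graph $G$ on $n$ vertices is equitable if for all $i,j$ (including $i=j$) there are constants $c_{i,j}$ such that every vertex of $V_i$ has exactly $c_{i,j}$ neighbors in $V_j$. The normalized indicator matrix $P$ is the $n\times k$ matrix whose $j$-th column is the indicator vector of $V_j$ divided by its Euclidean norm $\sqrt{|V_j|}$, so $P^TP=I$. Equitability is equivalent to the existence of a $k\times k$ matrix $d$ with $AP=Pd$; this $d=P^TAP$ is called the symmetrized divisor matrix. For a matrix $\Sigma$ with orthonormal columns, the generalized isospectral reduction is $\mathcal{R}(\lambda,\Sigma,A)=\lambda I-\left(\Sigma^*(\lambda I-A)^{-1}\Sigma\right)^{-1}$, a matrix of rational functions in the variable $\lambda$. *)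

theory Defs
  imports
    "HOL-Analysis.Analysis"
    "HOL-Computational_Algebra.Computational_Algebra"
begin

text \<open>
  Graphs are finite and simple: the vertex set is a finite type \<open>'n\<close> and the edge set is a
  symmetric irreflexive relation. The parts of a partition are indexed by a finite type \<open>'k\<close>,
  so that an \<open>n \<times> k\<close> matrix has type \<open>complex ^ 'k ^ 'n\<close>.
\<close>

definition simple_graph :: "('n::finite \<Rightarrow> 'n \<Rightarrow> bool) \<Rightarrow> bool" where
  "simple_graph E \<longleftrightarrow> symp E \<and> irreflp E"

definition adjacency_matrix :: "('n::finite \<Rightarrow> 'n \<Rightarrow> bool) \<Rightarrow> complex ^ 'n ^ 'n" where
  "adjacency_matrix E = (\<chi> v w. if E v w then 1 else 0)"

definition vertex_partition :: "('k::finite \<Rightarrow> 'n::finite set) \<Rightarrow> bool" where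
  "vertex_partition V \<longleftrightarrow> inj V \<and> partition_on UNIV (range V)"

definition equitable_partition ::
    "('n::finite \<Rightarrow> 'n \<Rightarrow> bool) \<Rightarrow> ('k::finite \<Rightarrow> 'n set) \<Rightarrow> bool" where
  "equitable_partition E V \<longleftrightarrow> vertex_partition V \<and>
     (\<exists>c :: 'k \<Rightarrow> 'k \<Rightarrow> nat. \<forall>i j. \<forall>v \<in> V i. card {w \<in> V j. E v w} = c i j)"

definition normalized_indicator :: "('k::finite \<Rightarrow> 'n::finite set) \<Rightarrow> complex ^ 'k ^ 'n" where
  "normalized_indicator V =
     (\<chi> v j. if v \<in> V j then complex_of_real (1 / sqrt (real (card (V j)))) else 0)"

definition symmetrized_divisor_matrix ::
    "('n::finite \<Rightarrow> 'n \<Rightarrow> bool) \<Rightarrow> ('k::finite \<Rightarrow> 'n set) \<Rightarrow> complex ^ 'k ^ 'k" where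
  "symmetrized_divisor_matrix E V =
     transpose (normalized_indicator V) ** adjacency_matrix E ** normalized_indicator V"

text \<open>
  Rational functions in one variable over the complex numbers form the field
  \<open>complex poly fract\<close>; \<open>lam\<close> is the variable, and complex matrices are regarded as matrices of
  constant rational functions. Note that \<open>mat lam\<close> is the scalar matrix \<open>lam I\<close>.
\<close>

definition lam :: "complex poly fract" where
  "lam = to_fract [:0, 1:]"

definition const_matrix :: "complex ^ 'm ^ 'n \<Rightarrow> complex poly fract ^ 'm::finite ^ 'n::finite" where
  "const_matrix M = map_matrix (\<lambda>c. to_fract [:c:]) M"

definition conjugate_transpose :: "complex ^ 'm::finite ^ 'n::finite \<Rightarrow> complex ^ 'n ^ 'm" where
  "conjugate_transpose M = map_matrix cnj (transpose M)"

definition compressed_resolvent ::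
    "complex ^ 'k ^ 'n \<Rightarrow> complex ^ 'n ^ 'n \<Rightarrow> complex poly fract ^ 'k::finite ^ 'k" where
  "compressed_resolvent \<Sigma> A =
     const_matrix (conjugate_transpose \<Sigma>) **
     matrix_inv (mat lam - const_matrix A) ** const_matrix (\<Sigma> :: complex ^ 'k ^ 'n::finite)"

definition isospectral_reduction ::
    "complex ^ 'k ^ 'n \<Rightarrow> complex ^ 'n ^ 'n \<Rightarrow> complex poly fract ^ 'k::finite ^ 'k" where
  "isospectral_reduction \<Sigma> A =
     mat lam - matrix_inv (compressed_resolvent \<Sigma> (A :: complex ^ 'n::finite ^ 'n))"

text \<open>
  The operator \<open>matrix_inv\<close> is total, with an unspecified value on singular matrices. The following
  predicate says that both inverses in the formula for the reduction genuinely exist.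
\<close>

definition isospectral_reduction_defined ::
    "complex ^ 'k ^ 'n \<Rightarrow> complex ^ 'n ^ 'n \<Rightarrow> bool" where
  "isospectral_reduction_defined \<Sigma> A \<longleftrightarrow>
     invertible (mat lam - const_matrix (A :: complex ^ 'n::finite ^ 'n)) \<and>
     invertible (compressed_resolvent (\<Sigma> :: complex ^ 'k::finite ^ 'n) A)"

end

theory Submission
  imports Defs
begin

text \<open>
  If the columns of \<open>P\<close> are orthonormal and \<open>A P = P d\<close>, then
  \<open>(\<lambda> I - A) P = P (\<lambda> I - d)\<close>, so \<open>P\<^sup>* (\<lambda> I - A)\<inverse> P = (\<lambda> I - d)\<inverse>\<close>,
  whose inverse is \<open>\<lambda> I - d\<close>. Both \<open>\<lambda> I - A\<close> and \<open>\<lambda> I - d\<close> are invertible over the rational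
  functions, because a polynomial vector in the kernel would have its maximal degree raised by
  \<open>\<lambda>\<close> but not by a constant matrix.
\<close>

no_notation fps_nth (infixl \<open>$\<close> 75)

section \<open>Matrix algebra and the embedding of constant matrices\<close>

lemma matrix_diff_ldistrib: "A ** (B - C) = A ** B - A ** C"
  for A :: "'a::ring_1 ^ 'm ^ 'n" and B C :: "'a ^ 'p ^ 'm"
  by (simp add: vec_eq_iff matrix_matrix_mult_def right_diff_distrib sum_subtractf)

lemma matrix_diff_rdistrib: "(A - B) ** C = A ** C - B ** C"
  for A B :: "'a::ring_1 ^ 'm ^ 'n" and C :: "'a ^ 'p ^ 'm"
  by (simp add: vec_eq_iff matrix_matrix_mult_def left_diff_distrib sum_subtractf)

lemma mat_mult_component: "(mat c ** A) $ i $ j = c * A $ i $ j"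
  for A :: "'a::semiring_1 ^ 'm ^ 'n"
  by (simp add: matrix_matrix_mult_def mat_def if_distrib[of "\<lambda>x. x * _"] cong: if_cong)

lemma mult_mat_component: "(A ** mat c) $ i $ j = A $ i $ j * c"
  for A :: "'a::semiring_1 ^ 'm ^ 'n"
  by (simp add: matrix_matrix_mult_def mat_def if_distrib[of "\<lambda>x. _ * x"] cong: if_cong)

text \<open>For rectangular \<open>A\<close> the two scalar matrices have different sizes; this is
  how \<lambda> passes through \<open>P\<close>.\<close>

lemma mat_mult_commute: "mat c ** A = A ** mat c"
  for A :: "'a::comm_semiring_1 ^ 'm ^ 'n"
  by (simp add: vec_eq_iff mat_mult_component mult_mat_component mult.commute)

lemma invertible_matrix_inv:
  fixes A :: "'a::semiring_1 ^ 'n ^ 'm"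
  assumes "invertible A"
  shows "A ** matrix_inv A = mat 1" "matrix_inv A ** A = mat 1"
  using someI_ex[OF assms[unfolded invertible_def]] by (auto simp: matrix_inv_def)

lemma matrix_inv_unique:
  fixes A :: "'a::semiring_1 ^ 'n ^ 'n"
  assumes "A ** B = mat 1" "B ** A = mat 1"
  shows "matrix_inv A = B"
proof -
  have "invertible A"
    using assms by (auto simp: invertible_def)
  then have "matrix_inv A ** A ** B = B"
    by (simp add: invertible_matrix_inv)
  then show ?thesis
    by (simp add: assms flip: matrix_mul_assoc)
qed

lemma to_fract_const_sum: "to_fract [:sum f S:] = (\<Sum>i\<in>S. to_fract [:f i:])"
proof -
  have "to_fract [:a + b:] = to_fract [:a:] + to_fract [:b:]" for a b :: 'a
    by (simp flip: to_fract_add)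
  then show ?thesis
    by (induction S rule: infinite_finite_induct) simp_all
qed

text \<open>Embedding scalars as constant rational functions is a ring homomorphism. This carries
  \<open>A ** P = P ** d\<close> and the orthonormality of \<open>P\<close> over to the rational
  functions.\<close>

lemma const_matrix_mult: "const_matrix (A ** B) = const_matrix A ** const_matrix B"
  by (simp add: const_matrix_def vec_eq_iff matrix_matrix_mult_def to_fract_const_sum mult.commute
      flip: to_fract_mult)

lemma const_matrix_mat_1: "const_matrix (mat 1) = mat 1"
  by (simp add: const_matrix_def vec_eq_iff mat_def flip: one_pCons)

section \<open>Invertibility of \<lambda> I - M over the rational functions\<close>

lemma fract_vector_common_denominator:
  fixes x :: "'a::idom fract ^ 'n"
  obtains q p where "q \<noteq> 0" "\<And>i. to_fract q * x $ i = to_fract (p i)"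
proof -
  have "\<exists>a b. b \<noteq> 0 \<and> to_fract b * x $ i = to_fract a" for i
    by (cases "x $ i") (auto simp: Fract_conv_to_fract intro!: exI)
  then obtain a b where b: "\<And>i. b i \<noteq> 0"
    and x: "\<And>i. to_fract (b i) * x $ i = to_fract (a i)"
    by metis
  \<comment> \<open>Take the product of all denominators; in entry \<open>i\<close> the factor
    \<open>b i\<close> cancels and the remaining factors multiply the numerator.\<close>
  define q where "q = (\<Prod>i\<in>UNIV. b i)"
  have "q \<noteq> 0"
    using b by (simp add: q_def)
  moreover have "to_fract q * x $ i = to_fract ((\<Prod>j\<in>UNIV - {i}. b j) * a i)" for i
  proof -
    have "q = (\<Prod>j\<in>UNIV - {i}. b j) * b i"
      unfolding q_def by (subst prod.remove[of UNIV i]) (simp_all add: mult.commute)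
    then show ?thesis
      by (simp add: mult.assoc x)
  qed
  ultimately show ?thesis
    by (rule that)
qed

lemma constant_matrix_no_polynomial_eigenvector:
  fixes M :: "'a::idom ^ 'n ^ 'n" and p :: "'n::finite \<Rightarrow> 'a poly"
  assumes eq: "\<And>i. [:0, 1:] * p i = (\<Sum>j\<in>UNIV. [:M $ i $ j:] * p j)"
  shows "p i = 0"
proof (rule ccontr)
  assume "p i \<noteq> 0"
  \<comment> \<open>Zero entries are excluded because they have degree 0 by convention: the maximum
    must be attained at a nonzero \<open>p k\<close> for \<lambda> to raise its degree to
    \<open>Suc D\<close>.\<close>
  define D where "D = Max ((degree \<circ> p) ` {i. p i \<noteq> 0})"
  have "D \<in> (degree \<circ> p) ` {i. p i \<noteq> 0}"
    unfolding D_def using \<open>p i \<noteq> 0\<close> by (intro Max_in) auto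
  then obtain k where k: "p k \<noteq> 0" "degree (p k) = D"
    by auto
  have le: "degree (p j) \<le> D" for j
    by (cases "p j = 0") (auto simp: D_def intro!: Max_ge)
  have "degree (\<Sum>j\<in>UNIV. [:M $ k $ j:] * p j) \<le> D"
    using le by (intro degree_sum_le) (auto intro: order_trans[OF degree_smult_le])
  moreover have "degree ([:0, 1:] * p k) = Suc D"
    using k by (simp add: degree_mult_eq)
  ultimately show False
    using eq[of k] by (metis not_less_eq_eq order_refl)
qed

lemma invertible_lam_diff_const_matrix:
  fixes M :: "complex ^ 'n ^ 'n"
  shows "invertible (mat lam - const_matrix M)"
  \<comment> \<open>Over a field a square matrix with trivial kernel is invertible. Clearing
    denominators in a kernel vector makes degrees available.\<close>
  unfolding invertible_left_inverse matrix_left_invertible_ker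
proof (intro allI impI)
  fix x :: "complex poly fract ^ 'n"
  assume 0: "(mat lam - const_matrix M) *v x = 0"
  obtain q p where q: "q \<noteq> 0" and p: "\<And>i. to_fract q * x $ i = to_fract (p i)"
    using fract_vector_common_denominator[of x] by metis
  have x: "lam * x $ i = (\<Sum>j\<in>UNIV. to_fract [:M $ i $ j:] * x $ j)" for i
  proof -
    have "((mat lam - const_matrix M) *v x) $ i
        = lam * x $ i - (\<Sum>j\<in>UNIV. to_fract [:M $ i $ j:] * x $ j)"
      by (simp add: matrix_vector_mult_def const_matrix_def mat_def left_diff_distrib
          sum_subtractf if_distrib[of "\<lambda>x. x * _"] cong: if_cong)
    with 0 show ?thesis
      by simp
  qed
  \<comment> \<open>Scaled by \<open>q\<close>, the kernel equation relates images of polynomials,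
    and \<open>to_fract\<close> is injective.\<close>
  have "[:0, 1:] * p i = (\<Sum>j\<in>UNIV. [:M $ i $ j:] * p j)" for i
  proof -
    have "to_fract ([:0, 1:] * p i) = to_fract q * (lam * x $ i)"
      unfolding to_fract_mult lam_def by (simp only: p[symmetric] mult_ac)
    also have "\<dots> = (\<Sum>j\<in>UNIV. to_fract [:M $ i $ j:] * to_fract (p j))"
      by (simp only: x sum_distrib_left p[symmetric] mult_ac)
    also have "\<dots> = to_fract (\<Sum>j\<in>UNIV. [:M $ i $ j:] * p j)"
      by (simp only: to_fract_sum to_fract_mult)
    finally show ?thesis
      by (simp only: to_fract_eq_iff)
  qed
  then have "p i = 0" for i
    by (rule constant_matrix_no_polynomial_eigenvector)
  with p q show "x = 0"
    by (simp add: vec_eq_iff)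
qed

section \<open>The reduction along an intertwining matrix\<close>

lemma isospectral_reduction_of_intertwining:
  fixes A :: "complex ^ 'n ^ 'n" and P :: "complex ^ 'k ^ 'n" and d :: "complex ^ 'k ^ 'k"
  assumes orthonormal: "conjugate_transpose P ** P = mat 1"
    and intertwining: "A ** P = P ** d"
  shows "isospectral_reduction_defined P A" "const_matrix d = isospectral_reduction P A"
proof -
  define L where "L = mat lam - const_matrix A"
  define K where "K = mat lam - const_matrix d"
  have L: "invertible L" and K: "invertible K"
    by (simp_all add: L_def K_def invertible_lam_diff_const_matrix)
  have "L ** const_matrix P = const_matrix P ** K"
    by (simp add: L_def K_def matrix_diff_ldistrib matrix_diff_rdistrib mat_mult_commute
        intertwining flip: const_matrix_mult)
  \<comment> \<open>Multiplying by \<open>matrix_inv L\<close> on the left and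
    \<open>matrix_inv K\<close> on the right trades the large resolvent for the small one across
    \<open>P\<close>.\<close>
  then have "matrix_inv L ** L ** const_matrix P ** matrix_inv K
      = matrix_inv L ** const_matrix P ** (K ** matrix_inv K)"
    by (simp flip: matrix_mul_assoc)
  then have "matrix_inv L ** const_matrix P = const_matrix P ** matrix_inv K"
    by (simp add: L K invertible_matrix_inv)
  then have "compressed_resolvent P A
      = const_matrix (conjugate_transpose P ** P) ** matrix_inv K"
    unfolding compressed_resolvent_def L_def[symmetric]
    by (simp add: const_matrix_mult flip: matrix_mul_assoc)
  then have resolvent: "compressed_resolvent P A = matrix_inv K"
    by (simp add: orthonormal const_matrix_mat_1)
  have "invertible (matrix_inv K)"
    using invertible_matrix_inv[OF K] by (auto simp: invertible_def)
  then show "isospectral_reduction_defined P A"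
    using L by (simp add: isospectral_reduction_defined_def resolvent L_def)
  have "matrix_inv (matrix_inv K) = K"
    by (intro matrix_inv_unique invertible_matrix_inv K)
  then show "const_matrix d = isospectral_reduction P A"
    by (simp add: isospectral_reduction_def resolvent K_def)
qed

section \<open>Equitable partitions\<close>

lemma conjugate_transpose_normalized_indicator:
  "conjugate_transpose (normalized_indicator V) = transpose (normalized_indicator V)"
  \<comment> \<open>The entries are real, so conjugation fixes them.\<close>
  by (simp add: conjugate_transpose_def normalized_indicator_def vec_eq_iff transpose_def)

lemma vertex_partitionD:
  assumes "vertex_partition V"
  shows "V i \<noteq> {}" "v \<in> V i \<Longrightarrow> v \<in> V j \<Longrightarrow> i = j" "\<exists>i. v \<in> V i"
proof -
  have "inj V" "disjoint (range V)" "{} \<notin> range V" "\<Union>(range V) = UNIV"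
    using assms by (auto simp: vertex_partition_def partition_on_def)
  then show "V i \<noteq> {}" "\<exists>i. v \<in> V i"
    by auto
  show "i = j" if "v \<in> V i" "v \<in> V j"
  proof -
    \<comment> \<open>Disjointness only identifies the parts as sets; injectivity of
      \<open>V\<close> then identifies their indices.\<close>
    have "V i = V j"
      using \<open>disjoint (range V)\<close> that by (auto simp: disjoint_def)
    with \<open>inj V\<close> show ?thesis
      by (rule injD)
  qed
qed

lemma normalized_indicator_orthonormal:
  assumes "vertex_partition V"
  shows "transpose (normalized_indicator V) ** normalized_indicator V = mat 1"
proof -
  have "(transpose (normalized_indicator V) ** normalized_indicator V) $ i $ j
      = mat 1 $ i $ j" for i j
  proof (cases "i = j")
    case True
    have "card (V i) > 0"
      using vertex_partitionD(1)[OF assms] by (simp add: card_gt_0_iff)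
    then have *: "complex_of_real (1 / sqrt (card (V i))) * complex_of_real (1 / sqrt (card (V i)))
        = 1 / of_nat (card (V i))"
      by (simp flip: of_real_mult)
    have "(transpose (normalized_indicator V) ** normalized_indicator V) $ i $ i
        = (\<Sum>v\<in>UNIV. if v \<in> V i then 1 / of_nat (card (V i)) else 0)"
      unfolding matrix_matrix_mult_def transpose_def normalized_indicator_def *[symmetric]
      by (auto intro!: sum.cong)
    \<comment> \<open>There are \<open>card (V i)\<close> equal summands; nonemptiness matters,
      since division by zero would give 0.\<close>
    also have "\<dots> = 1"
      using \<open>card (V i) > 0\<close> by (simp add: card_gt_0_iff flip: sum.inter_filter)
    finally show ?thesis
      using True by (simp add: mat_def)
  next
    case False
    then have "v \<notin> V i \<or> v \<notin> V j" for v
      using vertex_partitionD(2)[OF assms] by blast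
    with False show ?thesis
      by (auto simp: matrix_matrix_mult_def transpose_def normalized_indicator_def mat_def
          intro!: sum.neutral)
  qed
  then show ?thesis
    by (simp add: vec_eq_iff)
qed

text \<open>Since \<open>d\<close> is defined as P^T A P, the identity requires A P to factor
  through P. Equitability supplies a factor \<open>B\<close>, and P^T P = I then forces
  \<open>B\<close> to be \<open>d\<close>.\<close>

lemma equitable_partition_intertwining:
  assumes "equitable_partition E V"
  shows "adjacency_matrix E ** normalized_indicator V
    = normalized_indicator V ** symmetrized_divisor_matrix E V"
proof -
  let ?A = "adjacency_matrix E" and ?P = "normalized_indicator V"
  obtain c where V: "vertex_partition V"
    and c: "\<And>i j v. v \<in> V i \<Longrightarrow> card {w \<in> V j. E v w} = c i j"
    using assms unfolding equitable_partition_def by metis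
  define s where "s i = complex_of_real (sqrt (card (V i)))" for i
  have s: "s i \<noteq> 0" for i
    using vertex_partitionD(1)[OF V] by (simp add: s_def card_eq_0_iff)
  \<comment> \<open>With X the 0/1 indicator matrix, C the matrix of the \<open>c i j\<close> and S
    the diagonal matrix of the \<open>s i\<close>, equitability says A X = X C. As P = X S^-1, this
    gives A P = P (S C S^-1), and \<open>B\<close> is S C S^-1.\<close>
  define B where "B = (\<chi> i j. s i * of_nat (c i j) / s j)"
  have P: "?P $ v $ i = (if v \<in> V i then 1 / s i else 0)" for v i
    by (simp add: normalized_indicator_def s_def)
  have "(?A ** ?P) $ v $ j = (?P ** B) $ v $ j" for v j
  proof -
    obtain i where i: "v \<in> V i"
      using vertex_partitionD(3)[OF V] by blast
    have iff: "v \<in> V i' \<longleftrightarrow> i' = i" for i'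
      using i vertex_partitionD(2)[OF V] by blast
    \<comment> \<open>Each neighbor of \<open>v\<close> in \<open>V j\<close> contributes
      \<open>1 / s j\<close>, and there are \<open>c i j\<close> of them.\<close>
    have "(?A ** ?P) $ v $ j = (\<Sum>w\<in>UNIV. if w \<in> V j \<and> E v w then 1 / s j else 0)"
      by (auto simp: matrix_matrix_mult_def P adjacency_matrix_def intro!: sum.cong)
    also have "\<dots> = of_nat (c i j) / s j"
      using c[OF i, of j] by (simp flip: sum.inter_filter)
    also have "\<dots> = (?P ** B) $ v $ j"
      using s by (simp add: matrix_matrix_mult_def P B_def iff if_distrib[of "\<lambda>x. x * _"]
          cong: if_cong flip: sum_divide_distrib)
    finally show ?thesis .
  qed
  then have AP: "?A ** ?P = ?P ** B"
    by (simp add: vec_eq_iff)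
  have "symmetrized_divisor_matrix E V = transpose ?P ** ?P ** B"
    by (simp add: symmetrized_divisor_matrix_def AP flip: matrix_mul_assoc)
  then show ?thesis
    by (simp add: AP normalized_indicator_orthonormal[OF V])
qed

theorem theorem2p21:
  fixes E :: "'n::finite \<Rightarrow> 'n \<Rightarrow> bool"
    and V :: "'k::finite \<Rightarrow> 'n set"
    and A :: "complex ^ 'n ^ 'n"
    and P :: "complex ^ 'k ^ 'n"
    and d :: "complex ^ 'k ^ 'k"
  assumes "simple_graph E"
    and "equitable_partition E V"
    and "A = adjacency_matrix E"
    and "P = normalized_indicator V"
    and "d = symmetrized_divisor_matrix E V"
  shows "isospectral_reduction_defined P A \<and>
         const_matrix d = isospectral_reduction P A"
proof -
  have "vertex_partition V"
    using assms(2) by (simp add: equitable_partition_def)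
  then have "conjugate_transpose P ** P = mat 1"
    by (simp add: assms(4) conjugate_transpose_normalized_indicator
        normalized_indicator_orthonormal)
  moreover have "A ** P = P ** d"
    using equitable_partition_intertwining[OF assms(2)] by (simp add: assms(3-5))
  ultimately show ?thesis
    using isospectral_reduction_of_intertwining by blast
qed

end
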